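(* Every metric value set is isomorphic to a metric value set of the form $(\mathbf{W}(V)/\mathbf{R}_{T},* )$; that is, for every metric value set $M$ there exist a non-empty set $V$ and a relation $\mathbf{R}$ in $\mathbf{W}(V)$ of the admissible form described in the context such that $(\mathbf{W}(V)/\mathbf{R}_T,* )$ is a metric value set and is isomorphic to $M$.
   Context: A metric value set (MVS) is a set $M$ with at least two elements and a binary operation $+$ such that: (M1) $+$ is associative; (M2) $+$ has a (then unique) neutral element $e_M$ (write $M^{*}=M\setminus\{e_M\}$); (M3) if $m_1+m_2=e_M$ then $m_1=m_2=e_M$; (M4) for every $m_1,m_2\in M^{*}$ there are $m_3\in M^{*}$ and $m_4,m_5\in M$ with $m_1=m_3+m_4$ and $m_2=m_3+m_5$. A homomorphism $h\colon M_1\to M_2$ of MVSs is a map such that, for all $m\in M_1$, $h(m)=e_{M_2}$ if and only if $m=e_{M_1}$, and $h(m+n)=h(m)+h(n)$ for all $m,n\in M_1$. An isomorphism is a bijective homomorphism; two MVSs are isomorphic if there is an isomorphism between them. For a non-empty set $V$, $\mathbf{W}(V)$ is the set of all words over $V$, i.e. finite sequences $v_1\ldots v_n$ of elements of $V$, including the empty word $0$ ($n=0$); $*$ denotes concatenation of words. For $a,b,c\in V$, $R_{ab\sim c}$ is the relation in $\mathbf{W}(V)$ in which $v\,R_{ab\sim c}\,u$ if and only if $u=v$, or $u$ is obtained from $v$ by replacing one occurrence of the consecutive letters $ab$ by $c$, or one occurrence of $c$ by $ab$. The admissible relations $\mathbf{R}$ are the unions of the identity relation $\operatorname{id}_{\mathbf{W}(V)}$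 with an arbitrary (possibly empty) family of relations of the form $R_{ab\sim c}$, $a,b,c\in V$. $\mathbf{R}_T$ denotes the transitive closure of $\mathbf{R}$ (the smallest transitive relation containing $\mathbf{R}$). It is an equivalence relation compatible with concatenation, and $\mathbf{W}(V)/\mathbf{R}_T$ is the set of its equivalence classes with the operation $[u]*[v]=[u*v]$. *)

theory Defs
  imports "HOL-Algebra.Group"
begin

(* The operation + of a metric value set is the monoid operation \<otimes>, its neutral element
   is \<one>.  The conditions (M1), (M2) and closure are those of the locale monoid. *)
locale metric_value_set = monoid M for M (structure) +
  assumes two_elements: "\<exists>x\<in>carrier M. \<exists>y\<in>carrier M. x \<noteq> y"
    and M3: "\<lbrakk>m1 \<in> carrier M; m2 \<in> carrier M; m1 \<otimes> m2 = \<one>\<rbrakk> \<Longrightarrow> m1 = \<one> \<and> m2 = \<one>"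
    and M4: "\<lbrakk>m1 \<in> carrier M - {\<one>}; m2 \<in> carrier M - {\<one>}\<rbrakk> \<Longrightarrow>
      \<exists>m3\<in>carrier M - {\<one>}. \<exists>m4\<in>carrier M. \<exists>m5\<in>carrier M. m1 = m3 \<otimes> m4 \<and> m2 = m3 \<otimes> m5"

definition mvs_hom :: "('a, 'm) monoid_scheme \<Rightarrow> ('b, 'n) monoid_scheme \<Rightarrow> ('a \<Rightarrow> 'b) set" where
  "mvs_hom M N = {h \<in> hom M N. \<forall>m\<in>carrier M. h m = \<one>\<^bsub>N\<^esub> \<longleftrightarrow> m = \<one>\<^bsub>M\<^esub>}"

definition mvs_iso :: "('a, 'm) monoid_scheme \<Rightarrow> ('b, 'n) monoid_scheme \<Rightarrow> ('a \<Rightarrow> 'b) set" where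
  "mvs_iso M N = {h \<in> mvs_hom M N. bij_betw h (carrier M) (carrier N)}"

definition mvs_isomorphic :: "('a, 'm) monoid_scheme \<Rightarrow> ('b, 'n) monoid_scheme \<Rightarrow> bool" where
  "mvs_isomorphic M N \<longleftrightarrow> mvs_iso M N \<noteq> {}"

(* Words over V are the elements of lists V; the empty word is []. *)

definition replace_rel :: "'a set \<Rightarrow> 'a \<Rightarrow> 'a \<Rightarrow> 'a \<Rightarrow> ('a list \<times> 'a list) set" where
  "replace_rel V a b c = {(v, u). v \<in> lists V \<and> u \<in> lists V \<and>
     (u = v \<or>
      (\<exists>x y. v = x @ [a, b] @ y \<and> u = x @ [c] @ y) \<or>
      (\<exists>x y. v = x @ [c] @ y \<and> u = x @ [a, b] @ y))}"

definition admissible_rel :: "'a set \<Rightarrow> ('a list \<times> 'a list) set \<Rightarrow> bool" where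
  "admissible_rel V R \<longleftrightarrow>
     (\<exists>F \<subseteq> V \<times> V \<times> V. R = Id_on (lists V) \<union> (\<Union>(a, b, c)\<in>F. replace_rel V a b c))"

(* The product of two classes is given as a union over all representatives; for admissible R
   all members of this union coincide, see word_quotient_mult. *)
definition word_quotient :: "'a set \<Rightarrow> ('a list \<times> 'a list) set \<Rightarrow> 'a list set monoid" where
  "word_quotient V R =
     \<lparr>carrier = lists V // R\<^sup>+,
      mult = (\<lambda>A B. \<Union>u\<in>A. \<Union>v\<in>B. R\<^sup>+ `` {u @ v}),
      one = R\<^sup>+ `` {[]}\<rparr>"

lemma replace_rel_sym: "(v, u) \<in> replace_rel V a b c \<Longrightarrow> (u, v) \<in> replace_rel V a b c"
  unfolding replace_rel_def by blast

lemma replace_rel_context: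
  assumes "(v, u) \<in> replace_rel V a b c" "p \<in> lists V" "q \<in> lists V"
  shows "(p @ v @ q, p @ u @ q) \<in> replace_rel V a b c"
proof -
  have "v \<in> lists V" "u \<in> lists V"
    using assms(1) unfolding replace_rel_def by blast+
  then have words: "p @ v @ q \<in> lists V" "p @ u @ q \<in> lists V"
    using assms(2,3) by simp_all
  consider "u = v"
    | x y where "v = x @ [a, b] @ y" "u = x @ [c] @ y"
    | x y where "v = x @ [c] @ y" "u = x @ [a, b] @ y"
    using assms(1) unfolding replace_rel_def by blast
  then show ?thesis
  proof cases
    case 1
    then show ?thesis using words unfolding replace_rel_def by blast
  next
    case 2
    then have "p @ v @ q = (p @ x) @ [a, b] @ (y @ q)" "p @ u @ q = (p @ x) @ [c] @ (y @ q)"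
      by simp_all
    then show ?thesis using words unfolding replace_rel_def by blast
  next
    case 3
    then have "p @ v @ q = (p @ x) @ [c] @ (y @ q)" "p @ u @ q = (p @ x) @ [a, b] @ (y @ q)"
      by simp_all
    then show ?thesis using words unfolding replace_rel_def by blast
  qed
qed

lemma admissible_rel_equiv:
  assumes "admissible_rel V R"
  shows "equiv (lists V) (R\<^sup>+)"
proof (rule equivI)
  obtain F where R: "R = Id_on (lists V) \<union> (\<Union>(a, b, c)\<in>F. replace_rel V a b c)"
    using assms unfolding admissible_rel_def by blast
  have sub: "R \<subseteq> lists V \<times> lists V"
    unfolding R replace_rel_def by auto
  then show "R\<^sup>+ \<subseteq> lists V \<times> lists V"
    by (rule trancl_subset_Sigma)
  show "refl_on (lists V) (R\<^sup>+)"
    unfolding refl_on_def R by auto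
  have "sym R"
    unfolding R sym_def using replace_rel_sym by fastforce
  then show "sym (R\<^sup>+)"
    by (rule sym_trancl)
  show "trans (R\<^sup>+)"
    by (rule trans_trancl)
qed

lemma admissible_rel_context:
  assumes "admissible_rel V R" "(v, u) \<in> R\<^sup>+" "p \<in> lists V" "q \<in> lists V"
  shows "(p @ v @ q, p @ u @ q) \<in> R\<^sup>+"
proof -
  obtain F where R: "R = Id_on (lists V) \<union> (\<Union>(a, b, c)\<in>F. replace_rel V a b c)"
    using assms(1) unfolding admissible_rel_def by blast
  have step: "(p @ v @ q, p @ u @ q) \<in> R" if "(v, u) \<in> R" for v u
    using that assms(3,4) replace_rel_context unfolding R by fastforce
  from assms(2) show ?thesis
    by (induction rule: trancl_induct) (auto intro: step trancl_into_trancl)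
qed

lemma word_quotient_mult:
  assumes R: "admissible_rel V R" and u: "u \<in> lists V" and v: "v \<in> lists V"
  shows "R\<^sup>+ `` {u} \<otimes>\<^bsub>word_quotient V R\<^esub> R\<^sup>+ `` {v} = R\<^sup>+ `` {u @ v}"
proof -
  note eq = admissible_rel_equiv[OF R]
  have "congruent2 (R\<^sup>+) (R\<^sup>+) (\<lambda>u v. R\<^sup>+ `` {u @ v})"
  proof (rule congruent2I[OF eq eq])
    fix y z w assume "(y, z) \<in> R\<^sup>+" "w \<in> lists V"
    then have "(y @ w, z @ w) \<in> R\<^sup>+" "(w @ y, w @ z) \<in> R\<^sup>+"
      using admissible_rel_context[OF R, of y z "[]" w] admissible_rel_context[OF R, of y z w "[]"]
      by auto
    then show "R\<^sup>+ `` {y @ w} = R\<^sup>+ `` {z @ w}" "R\<^sup>+ `` {w @ y} = R\<^sup>+ `` {w @ z}"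
      by (simp_all add: equiv_class_eq[OF eq])
  qed
  then show ?thesis
    unfolding word_quotient_def by (simp add: UN_equiv_class2[OF eq eq _ u v])
qed

end

theory Submission
  imports Defs
begin

text \<open>
  The idea is that a monoid is presented by its own multiplication table. Take the alphabet
  \<open>V = M\<^sup>*\<close> and, for all \<open>a, b \<in> M\<^sup>*\<close>, the relation that identifies \<open>ab\<close> with the single letter
  \<open>a \<otimes> b\<close>. By (M3) this product is again a letter, so the relation is admissible.

  A word is evaluated by multiplying its letters. The value is invariant under the relations
  (\<open>related_words_same_product\<close>). Conversely, contracting the word letter by letter relates it to a
  normal form determined by its value: the empty word if the value is the neutral element and the
  one-letter word of the value otherwise (\<open>word_related_to_normal_form\<close>). (M3) enters here once more:
  only the empty word has the neutral element as its value. Two words are therefore related exactly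
  if they have the same value, and \<open>m \<mapsto> [normal form of m]\<close> is a multiplicative bijection from \<open>M\<close>
  onto the quotient. All axioms of a metric value set are invariant under such bijections
  (\<open>metric_value_set_transfer\<close>).
\<close>

text \<open>
  Surjectivity carries the monoid laws over to \<open>N\<close>, and injectivity pulls equations in \<open>N\<close> back to
  \<open>M\<close>. A priori the unit recorded in \<open>N\<close> need not be neutral for its product, so its being the image
  of the unit of \<open>M\<close> is a condition of its own.
\<close>

lemma metric_value_set_transfer:
  fixes M :: "('a, 'm) monoid_scheme" and N :: "('b, 'n) monoid_scheme"
  assumes M: "metric_value_set M"
    and bij: "bij_betw g (carrier M) (carrier N)"
    and mult: "\<And>x y. \<lbrakk>x \<in> carrier M; y \<in> carrier M\<rbrakk> \<Longrightarrow> g (x \<otimes>\<^bsub>M\<^esub> y) = g x \<otimes>\<^bsub>N\<^esub> g y"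
    and one: "g \<one>\<^bsub>M\<^esub> = \<one>\<^bsub>N\<^esub>"
  shows "metric_value_set N" and "mvs_isomorphic N M"
proof -
  interpret M: metric_value_set M by (rule M)
  have car: "carrier N = g ` carrier M"
    using bij by (simp add: bij_betw_def)
  have inj: "g x = g y \<longleftrightarrow> x = y" if "x \<in> carrier M" "y \<in> carrier M" for x y
    using bij that by (auto simp: bij_betw_def inj_on_def)
  have inv_g: "inv_into (carrier M) g (g x) = x" if "x \<in> carrier M" for x
    using bij that by (simp add: bij_betw_def)
  have g_one: "g x = \<one>\<^bsub>N\<^esub> \<longleftrightarrow> x = \<one>\<^bsub>M\<^esub>" if "x \<in> carrier M" for x
    using inj[OF that M.one_closed] one by simp
  have monoid: "monoid N"
  proof
    show "x \<otimes>\<^bsub>N\<^esub> y \<in> carrier N" if "x \<in> carrier N" "y \<in> carrier N" for x y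
      using that unfolding car by (auto simp flip: mult)
    show "x \<otimes>\<^bsub>N\<^esub> y \<otimes>\<^bsub>N\<^esub> z = x \<otimes>\<^bsub>N\<^esub> (y \<otimes>\<^bsub>N\<^esub> z)"
      if "x \<in> carrier N" "y \<in> carrier N" "z \<in> carrier N" for x y z
      using that unfolding car by (auto simp: M.m_assoc simp flip: mult)
    show "\<one>\<^bsub>N\<^esub> \<in> carrier N"
      unfolding car one[symmetric] by simp
    show "\<one>\<^bsub>N\<^esub> \<otimes>\<^bsub>N\<^esub> x = x" "x \<otimes>\<^bsub>N\<^esub> \<one>\<^bsub>N\<^esub> = x" if "x \<in> carrier N" for x
      using that unfolding car one[symmetric] by (auto simp flip: mult)
  qed
  show "metric_value_set N"
  proof (intro metric_value_set.intro metric_value_set_axioms.intro)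
    show "monoid N"
      by (rule monoid)
    show "\<exists>x\<in>carrier N. \<exists>y\<in>carrier N. x \<noteq> y"
      using M.two_elements inj unfolding car by blast
  next
    fix x y assume "x \<in> carrier N" "y \<in> carrier N" and xy: "x \<otimes>\<^bsub>N\<^esub> y = \<one>\<^bsub>N\<^esub>"
    then obtain m n where mn: "m \<in> carrier M" "n \<in> carrier M" "x = g m" "y = g n"
      unfolding car by blast
    then have "m \<otimes>\<^bsub>M\<^esub> n = \<one>\<^bsub>M\<^esub>"
      using xy g_one[of "m \<otimes>\<^bsub>M\<^esub> n"] mult by simp
    then show "x = \<one>\<^bsub>N\<^esub> \<and> y = \<one>\<^bsub>N\<^esub>"
      using M.M3 mn one by blast
  next
    fix x y assume "x \<in> carrier N - {\<one>\<^bsub>N\<^esub>}" "y \<in> carrier N - {\<one>\<^bsub>N\<^esub>}"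
    then obtain m n where mn: "m \<in> carrier M - {\<one>\<^bsub>M\<^esub>}" "n \<in> carrier M - {\<one>\<^bsub>M\<^esub>}"
      and xy: "x = g m" "y = g n"
      unfolding car using one by blast
    obtain p q r where "p \<in> carrier M - {\<one>\<^bsub>M\<^esub>}" "q \<in> carrier M" "r \<in> carrier M"
      "m = p \<otimes>\<^bsub>M\<^esub> q" "n = p \<otimes>\<^bsub>M\<^esub> r"
      using M.M4[OF mn] by blast
    then have "g p \<in> carrier N - {\<one>\<^bsub>N\<^esub>}" "g q \<in> carrier N" "g r \<in> carrier N"
      "x = g p \<otimes>\<^bsub>N\<^esub> g q" "y = g p \<otimes>\<^bsub>N\<^esub> g r"
      using g_one unfolding car xy by (auto simp: mult)
    then show "\<exists>a\<in>carrier N - {\<one>\<^bsub>N\<^esub>}. \<exists>b\<in>carrier N. \<exists>c\<in>carrier N.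
        x = a \<otimes>\<^bsub>N\<^esub> b \<and> y = a \<otimes>\<^bsub>N\<^esub> c"
      by blast
  qed
  have "inv_into (carrier M) g \<in> hom N M"
  proof (rule homI)
    show "inv_into (carrier M) g x \<in> carrier M" if "x \<in> carrier N" for x
      using that unfolding car by (rule inv_into_into)
    show "inv_into (carrier M) g (x \<otimes>\<^bsub>N\<^esub> y) =
        inv_into (carrier M) g x \<otimes>\<^bsub>M\<^esub> inv_into (carrier M) g y"
      if "x \<in> carrier N" "y \<in> carrier N" for x y
      using that unfolding car by (auto simp: inv_g simp flip: mult)
  qed
  moreover have "inv_into (carrier M) g y = \<one>\<^bsub>M\<^esub> \<longleftrightarrow> y = \<one>\<^bsub>N\<^esub>" if "y \<in> carrier N" for y
    using that unfolding car by (auto simp: inv_g g_one)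
  ultimately have "inv_into (carrier M) g \<in> mvs_iso N M"
    using bij_betw_inv_into[OF bij] unfolding mvs_iso_def mvs_hom_def by simp
  then show "mvs_isomorphic N M"
    unfolding mvs_isomorphic_def by blast
qed

context metric_value_set
begin

definition letters :: "'a set" where
  "letters = carrier M - {\<one>}"

definition word_product :: "'a list \<Rightarrow> 'a" where
  "word_product w = foldr (\<otimes>) w \<one>"

definition table_rel :: "('a list \<times> 'a list) set" where
  "table_rel = Id_on (lists letters) \<union>
     (\<Union>(a, b, c)\<in>{(a, b, a \<otimes> b) | a b. a \<in> letters \<and> b \<in> letters}. replace_rel letters a b c)"

definition normal_form :: "'a \<Rightarrow> 'a list" where
  "normal_form m = (if m = \<one> then [] else [m])"

lemma letters_mult: "a \<in> letters \<Longrightarrow> b \<in> carrier M \<Longrightarrow> a \<otimes> b \<in> letters"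
  using M3[of a b] by (auto simp: letters_def)

lemma letter_closed: "a \<in> letters \<Longrightarrow> a \<in> carrier M"
  unfolding letters_def by simp

lemma letters_nonempty: "letters \<noteq> {}"
  using two_elements by (auto simp: letters_def)

lemma admissible_table_rel: "admissible_rel letters table_rel"
proof -
  have "{(a, b, a \<otimes> b) | a b. a \<in> letters \<and> b \<in> letters} \<subseteq> letters \<times> letters \<times> letters"
    by (auto simp: letters_mult letter_closed)
  then show ?thesis
    unfolding admissible_rel_def table_rel_def by - (rule exI, rule conjI, assumption, rule refl)
qed

lemma table_rel_refl: "w \<in> lists letters \<Longrightarrow> (w, w) \<in> table_rel\<^sup>+"
  unfolding table_rel_def by (intro r_into_trancl UnI1 Id_onI)

lemma word_product_simps [simp]:
  "word_product [] = \<one>" "word_product (a # w) = a \<otimes> word_product w"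
  by (simp_all add: word_product_def)

lemma word_product_closed: "w \<in> lists letters \<Longrightarrow> word_product w \<in> carrier M"
  by (induction w) (auto simp: letter_closed)

lemma word_product_append:
  "\<lbrakk>v \<in> lists letters; w \<in> lists letters\<rbrakk> \<Longrightarrow>
    word_product (v @ w) = word_product v \<otimes> word_product w"
  by (induction v) (auto simp: letter_closed word_product_closed m_assoc)

lemma normal_form_in_lists: "m \<in> carrier M \<Longrightarrow> normal_form m \<in> lists letters"
  by (simp add: normal_form_def letters_def)

lemma word_product_normal_form: "m \<in> carrier M \<Longrightarrow> word_product (normal_form m) = m"
  by (simp add: normal_form_def)

text \<open>
  Replacing \<open>ab\<close> by \<open>a \<otimes> b\<close> only changes the bracketing of the product.
\<close>

lemma related_words_same_product:
  assumes "(v, w) \<in> table_rel\<^sup>+"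
  shows "word_product v = word_product w"
proof -
  have contract: "word_product (x @ a # b # y) = word_product (x @ (a \<otimes> b) # y)"
    if ab: "a \<in> letters" "b \<in> letters"
      and xy: "\<forall>z\<in>set x. z \<in> letters" "\<forall>z\<in>set y. z \<in> letters" for a b x y
  proof -
    have "x \<in> lists letters" "y \<in> lists letters"
      using xy by (simp_all add: in_lists_conv_set)
    then show ?thesis
      using ab
      by (simp add: word_product_append letter_closed letters_mult word_product_closed m_assoc)
  qed
  have step: "word_product v = word_product w" if "(v, w) \<in> table_rel" for v w
    using that unfolding table_rel_def replace_rel_def
    by (auto simp: contract ball_Un)
  from assms show ?thesis
    by (induction rule: trancl_induct) (auto dest: step)
qed

lemma table_rel_contract:
  assumes "a \<in> letters" "b \<in> letters"
  shows "([a, b], [a \<otimes> b]) \<in> table_rel"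
proof -
  have "[a, b] = [] @ [a, b] @ [] \<and> [a \<otimes> b] = [] @ [a \<otimes> b] @ []"
    by simp
  moreover have "[a, b] \<in> lists letters" "[a \<otimes> b] \<in> lists letters"
    using assms by (simp_all add: letters_mult letter_closed)
  ultimately have "([a, b], [a \<otimes> b]) \<in> replace_rel letters a b (a \<otimes> b)"
    unfolding replace_rel_def by blast
  then show ?thesis
    using assms unfolding table_rel_def by (intro UnI2 UN_I[of "(a, b, a \<otimes> b)"]) auto
qed

text \<open>
  Since a nonempty word never evaluates to the neutral element, each contraction leaves a letter,
  and the word shrinks until only its value remains.
\<close>

lemma word_related_to_normal_form:
  assumes "w \<in> lists letters"
  shows "(w, normal_form (word_product w)) \<in> table_rel\<^sup>+"
  using assms
proof (induction w rule: lists.induct)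
  case Nil
  then show ?case
    by (simp add: normal_form_def table_rel_refl)
next
  case (Cons a w)
  let ?p = "word_product w"
  have a: "a \<in> letters"
    by (rule Cons.hyps)
  have p: "?p \<in> carrier M"
    using Cons.hyps(2) by (rule word_product_closed)
  have ap: "a \<otimes> ?p \<noteq> \<one>"
    using letters_mult[OF a p] by (simp add: letters_def)
  have "(a # w, a # normal_form ?p) \<in> table_rel\<^sup>+"
    using admissible_rel_context[OF admissible_table_rel Cons.IH, of "[a]" "[]"] a by simp
  moreover have "(a # normal_form ?p, [a \<otimes> ?p]) \<in> table_rel\<^sup>+"
  proof (cases "?p = \<one>")
    case True
    then show ?thesis
      using a by (simp add: normal_form_def table_rel_refl letter_closed)
  next
    case False
    then show ?thesis
      using table_rel_contract[OF a, of ?p] p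
      by (simp add: normal_form_def letters_def r_into_trancl)
  qed
  ultimately have "(a # w, [a \<otimes> ?p]) \<in> table_rel\<^sup>+"
    by (rule trancl_trans)
  then show ?case
    using ap by (simp add: normal_form_def)
qed

lemma class_eq_normal_form_class:
  assumes "w \<in> lists letters"
  shows "table_rel\<^sup>+ `` {w} = table_rel\<^sup>+ `` {normal_form (word_product w)}"
  by (rule equiv_class_eq[OF admissible_rel_equiv[OF admissible_table_rel]
        word_related_to_normal_form[OF assms]])

lemma bij_betw_normal_form_class:
  "bij_betw (\<lambda>m. table_rel\<^sup>+ `` {normal_form m}) (carrier M)
     (carrier (word_quotient letters table_rel))"
proof (rule bij_betw_imageI)
  show "inj_on (\<lambda>m. table_rel\<^sup>+ `` {normal_form m}) (carrier M)"
  proof (rule inj_onI)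
    fix m n assume m: "m \<in> carrier M" and n: "n \<in> carrier M"
      and eq: "table_rel\<^sup>+ `` {normal_form m} = table_rel\<^sup>+ `` {normal_form n}"
    have "(normal_form m, normal_form n) \<in> table_rel\<^sup>+"
      using eq_equiv_class[OF eq admissible_rel_equiv[OF admissible_table_rel]]
        normal_form_in_lists[OF n] by blast
    then show "m = n"
      using related_words_same_product word_product_normal_form m n by metis
  qed
  show "(\<lambda>m. table_rel\<^sup>+ `` {normal_form m}) ` carrier M =
      carrier (word_quotient letters table_rel)"
  proof (intro equalityI subsetI)
    fix A assume "A \<in> (\<lambda>m. table_rel\<^sup>+ `` {normal_form m}) ` carrier M"
    then show "A \<in> carrier (word_quotient letters table_rel)"
      using normal_form_in_lists by (auto simp: word_quotient_def intro!: quotientI)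
  next
    fix A assume "A \<in> carrier (word_quotient letters table_rel)"
    then obtain w where "w \<in> lists letters" "A = table_rel\<^sup>+ `` {w}"
      unfolding word_quotient_def quotient_def by force
    then show "A \<in> (\<lambda>m. table_rel\<^sup>+ `` {normal_form m}) ` carrier M"
      using class_eq_normal_form_class word_product_closed by blast
  qed
qed

lemma normal_form_class_mult:
  assumes "m \<in> carrier M" "n \<in> carrier M"
  shows "table_rel\<^sup>+ `` {normal_form (m \<otimes> n)} =
    table_rel\<^sup>+ `` {normal_form m} \<otimes>\<^bsub>word_quotient letters table_rel\<^esub> table_rel\<^sup>+ `` {normal_form n}"
proof -
  let ?w = "normal_form m @ normal_form n"
  have "word_product ?w = m \<otimes> n"
    using assms by (simp add: word_product_append normal_form_in_lists word_product_normal_form)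
  moreover have "?w \<in> lists letters"
    using assms normal_form_in_lists by simp
  ultimately show ?thesis
    using class_eq_normal_form_class[of ?w] assms
    by (simp add: word_quotient_mult[OF admissible_table_rel] normal_form_in_lists)
qed

lemma normal_form_class_one:
  "table_rel\<^sup>+ `` {normal_form \<one>} = \<one>\<^bsub>word_quotient letters table_rel\<^esub>"
  by (simp add: normal_form_def word_quotient_def)

end

theorem theorem2p29:
  fixes M :: "('a, 'm) monoid_scheme"
  assumes "metric_value_set M"
  shows "\<exists>(V :: 'a set) (R :: ('a list \<times> 'a list) set).
    V \<noteq> {} \<and> admissible_rel V R \<and>
    metric_value_set (word_quotient V R) \<and>
    mvs_isomorphic (word_quotient V R) M"
proof -
  interpret metric_value_set M by (rule assms)
  note transfer = metric_value_set_transfer[OF assms bij_betw_normal_form_class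
      normal_form_class_mult normal_form_class_one]
  show ?thesis
    using letters_nonempty admissible_table_rel transfer by blast
qed

end
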